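(* Let $f: \mathbb{R}^2 \to \mathbb{R}$ be a function. Then the following are equivalent. (a) The function $f$ is transintegral polyhedral. (b) The restriction of $f$ to each horizontal line and each vertical line is transintegral polyhedral. (c) The restriction of $f$ to each translate of the set \[ L = \{(x,y) \in \mathbb{R}^2: x = 0,\ y \leq 0 \} \cup \{(x,y) \in \mathbb{R}^2: x \leq 0,\ y = 0\} \cup \{(x,y) \in \mathbb{R}^2: x = y \geq 0\} \] is transintegral polyhedral.
   Context: An affine functional $\lambda(x,y)=a_1x+a_2y+b$ on $\mathbb{R}^2$ is transintegral if $a_1,a_2\in\mathbb{Z}$ and $b\in\mathbb{R}$. For any subset $T\subseteq\mathbb{R}^2$, a function $g:T\to\mathbb{R}$ is transintegral polyhedral if $g(x)=\max\{\lambda_1(x),\dots,\lambda_m(x)\}$ for all $x\in T$, for some finite list of transintegral affine functionals $\lambda_1,\dots,\lambda_m$ on $\mathbb{R}^2$. *)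

theory Defs
  imports "HOL-Analysis.Analysis"
begin

definition transintegral_affine :: "(real \<times> real \<Rightarrow> real) \<Rightarrow> bool" where
  "transintegral_affine l \<longleftrightarrow>
     (\<exists>(a1::int) (a2::int) (b::real). \<forall>x y. l (x, y) = of_int a1 * x + of_int a2 * y + b)"

text \<open>
  A function on \<open>T\<close> is represented by a total function of which only the values on \<open>T\<close>
  matter, so the predicate also expresses that the restriction of \<open>g\<close> to \<open>T\<close> is
  transintegral polyhedral. The functionals are defined on the whole plane. The list must be
  nonempty for the maximum to make sense.
\<close>

definition transintegral_polyhedral_on ::
    "(real \<times> real) set \<Rightarrow> (real \<times> real \<Rightarrow> real) \<Rightarrow> bool" where
  "transintegral_polyhedral_on T g \<longleftrightarrow>
     (\<exists>ls. ls \<noteq> [] \<and> (\<forall>l\<in>set ls. transintegral_affine l) \<and>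
        (\<forall>p\<in>T. g p = Max ((\<lambda>l. l p) ` set ls)))"

definition horizontal_line :: "real \<Rightarrow> (real \<times> real) set" where
  "horizontal_line c = {(x, y). y = c}"

definition vertical_line :: "real \<Rightarrow> (real \<times> real) set" where
  "vertical_line c = {(x, y). x = c}"

definition tripod :: "(real \<times> real) set" where
  "tripod = {(x, y). x = 0 \<and> y \<le> 0} \<union> {(x, y). x \<le> 0 \<and> y = 0} \<union> {(x, y). x = y \<and> y \<ge> 0}"

end

(*
  Both (b) and (c) say that all horizontal and vertical slices of f are convex and piecewise
  affine with integral slopes, together with a linear growth bound. A convex function with
  integral slopes that is affine near a point keeps its slope there under small perturbations.
  Hence wherever both slices of f through a point are smooth, f is affine nearby.

  This forces convexity: if f lay above a chord somewhere, then f minus an affine function and a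
  quadratic form that is negative along the chord would have a local maximum. There f is touched
  from above by a smooth function, so both slices are smooth and f is locally affine,
  contradicting the second-order condition along the chord.

  A convex f has integral supporting functionals at a dense set of points. The growth bound in
  the directions (-1,0), (0,-1), (1,1) leaves only finitely many slopes, hence finitely many
  functionals, so by continuity f is their maximum.
*)
theory Submission
  imports Defs
begin


section \<open>Convex piecewise affine functions of one variable with integral slopes\<close>

definition integral_germ :: "(real \<Rightarrow> real) \<Rightarrow> real \<Rightarrow> bool" where
  "integral_germ h x \<longleftrightarrow> (\<exists>k::int. \<forall>\<^sub>F t in at_right 0. h (x + t) = h x + of_int k * t)"

text \<open>The reflected germ at \<open>- x\<close> is the germ of \<open>h\<close> to the left of
  \<open>x\<close>. The condition is local: kinks cannot accumulate, but there may be infinitely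
  many along the line.\<close>

definition integral_pl :: "(real \<Rightarrow> real) \<Rightarrow> bool" where
  "integral_pl h \<longleftrightarrow> convex_on UNIV h \<and>
     (\<forall>x. integral_germ h x \<and> integral_germ (\<lambda>t. h (- t)) (- x))"

lemma integral_germ_affine: "integral_germ (\<lambda>t. of_int k * t + b) x"
  unfolding integral_germ_def by (intro exI[of _ k] always_eventually) (auto simp: algebra_simps)

lemma integral_germ_max_less:
  assumes "integral_germ g x" "integral_germ h x" "h x < g x"
  shows "integral_germ (\<lambda>t. max (g t) (h t)) x"
proof -
  obtain k l :: int where kl: "\<forall>\<^sub>F t in at_right 0. g (x + t) = g x + of_int k * t"
    "\<forall>\<^sub>F t in at_right 0. h (x + t) = h x + of_int l * t"
    using assms unfolding integral_germ_def by blast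
  have "((\<lambda>t. (g x + of_int k * t) - (h x + of_int l * t)) \<longlongrightarrow>
      (g x + of_int k * 0) - (h x + of_int l * 0)) (at_right 0)"
    by (intro tendsto_intros)
  then have "\<forall>\<^sub>F t in at_right 0. 0 < (g x + of_int k * t) - (h x + of_int l * t)"
    using assms(3) by (intro order_tendstoD(1)) auto
  with kl have "\<forall>\<^sub>F t in at_right 0. max (g (x + t)) (h (x + t)) = max (g x) (h x) + of_int k * t"
    by eventually_elim (use assms(3) in auto)
  then show ?thesis unfolding integral_germ_def by blast
qed

text \<open>At a tie the larger slope wins to the right of \<open>x\<close>; otherwise the strictly
  larger function stays larger nearby.\<close>

lemma integral_germ_max:
  assumes "integral_germ g x" "integral_germ h x"
  shows "integral_germ (\<lambda>t. max (g t) (h t)) x"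
proof (cases "g x" "h x" rule: linorder_cases)
  case equal
  obtain k l :: int where kl: "\<forall>\<^sub>F t in at_right 0. g (x + t) = g x + of_int k * t"
    "\<forall>\<^sub>F t in at_right 0. h (x + t) = h x + of_int l * t"
    using assms unfolding integral_germ_def by blast
  have "\<forall>\<^sub>F t::real in at_right 0. 0 < t"
    by (simp add: eventually_at_right_less)
  with kl have "\<forall>\<^sub>F t in at_right 0.
      max (g (x + t)) (h (x + t)) = max (g x) (h x) + of_int (max k l) * t"
    by eventually_elim
      (use equal in \<open>auto simp: max_def mult_right_mono\<close>)
  then show ?thesis unfolding integral_germ_def by blast
next
  case less
  then show ?thesis using integral_germ_max_less[OF assms(2,1)] by (simp add: max.commute)
next
  case greater
  then show ?thesis using integral_germ_max_less[OF assms] by simp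
qed

lemma integral_germ_Max:
  assumes "finite A" "A \<noteq> {}" "\<And>a. a \<in> A \<Longrightarrow> integral_germ (\<lambda>t. F a t) x"
  shows "integral_germ (\<lambda>t. Max ((\<lambda>a. F a t) ` A)) x"
  using assms
proof (induction A rule: finite_ne_induct)
  case (insert a A)
  then have "integral_germ (\<lambda>t. max (F a t) (Max ((\<lambda>a. F a t) ` A))) x"
    by (intro integral_germ_max) auto
  then show ?case using insert by simp
qed simp

lemma integral_germ_cong:
  assumes "integral_germ g x" "X > x" "\<And>t. t \<le> X \<Longrightarrow> h t = g t"
  shows "integral_germ h x"
proof -
  obtain k :: int where k: "\<forall>\<^sub>F t in at_right 0. g (x + t) = g x + of_int k * t"
    using assms(1) unfolding integral_germ_def by blast
  have "\<forall>\<^sub>F t in at_right 0. t < X - x"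
    using assms(2) by (intro eventually_at_rightI[of 0 "X - x"]) auto
  with k have "\<forall>\<^sub>F t in at_right 0. h (x + t) = h x + of_int k * t"
    by eventually_elim (use assms in auto)
  then show ?thesis unfolding integral_germ_def by blast
qed

text \<open>Serves the reflected function, for which agreement on a left half line becomes agreement
  on a right half line.\<close>

lemma integral_germ_cong':
  assumes "integral_germ g x" "\<And>t. t \<ge> x \<Longrightarrow> h t = g t"
  shows "integral_germ h x"
proof -
  obtain k :: int where k: "\<forall>\<^sub>F t in at_right 0. g (x + t) = g x + of_int k * t"
    using assms(1) unfolding integral_germ_def by blast
  have "\<forall>\<^sub>F t::real in at_right 0. 0 < t"
    by (simp add: eventually_at_right_less)
  with k have "\<forall>\<^sub>F t in at_right 0. h (x + t) = h x + of_int k * t"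
    by eventually_elim (use assms in auto)
  then show ?thesis unfolding integral_germ_def by blast
qed

text \<open>
  Half lines suffice here because a translate of the tripod contains only half of each axis-parallel line.
\<close>
lemma integral_plI:
  assumes "\<And>X::real. \<exists>A. finite A \<and> A \<noteq> {} \<and> (\<forall>t\<le>X. h t = Max ((\<lambda>(k::int, b). of_int k * t + b) ` A))"
  shows "integral_pl h"
  unfolding integral_pl_def
proof (intro conjI allI)
  show "convex_on UNIV h"
  proof (intro convex_onI)
    fix t x y :: real assume t: "t > 0" "t < 1"
    define z where "z = (1 - t) *\<^sub>R x + t *\<^sub>R y"
    obtain A where A: "finite A" "A \<noteq> {}"
      "\<And>t. t \<le> max x y \<Longrightarrow> h t = Max ((\<lambda>(k::int, b). of_int k * t + b) ` A)"
      using assms by blast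
    have "z \<le> max x y" unfolding z_def using convex_bound_le[of x "max x y" y "1 - t" t] t by simp
    \<comment> \<open>The functional attaining the maximum at \<open>z\<close> lies below
      \<open>h\<close> up to \<open>max x y\<close>; comparing it with \<open>h\<close> at
      \<open>x\<close> and \<open>y\<close> gives the convexity inequality.\<close>
    then have "h z \<in> (\<lambda>(k::int, b). of_int k * z + b) ` A"
      using A by simp
    then obtain k b where kb: "(k, b) \<in> A" "h z = of_int k * z + b" by auto
    have "of_int k * w + b \<le> h w" if "w \<le> max x y" for w
      using kb(1) A that by (force intro!: Max_ge)
    then have "(1 - t) * (of_int k * x + b) + t * (of_int k * y + b) \<le> (1 - t) * h x + t * h y"
      using t by (intro add_mono mult_left_mono) auto
    moreover have "h z = (1 - t) * (of_int k * x + b) + t * (of_int k * y + b)"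
      unfolding kb(2) by (simp add: z_def algebra_simps)
    ultimately show "h ((1 - t) *\<^sub>R x + t *\<^sub>R y) \<le> (1 - t) * h x + t * h y"
      unfolding z_def by simp
  qed simp
next
  fix x :: real
  obtain A where A: "finite A" "A \<noteq> {}"
      "\<And>t. t \<le> x + 1 \<Longrightarrow> h t = Max ((\<lambda>(k::int, b). of_int k * t + b) ` A)"
      using assms by blast
  define G where "G t = Max ((\<lambda>(k::int, b). of_int k * t + b) ` A)" for t :: real
  have "integral_germ G x" unfolding G_def
    using A integral_germ_affine by (intro integral_germ_Max) auto
  then show "integral_germ h x"
    by (rule integral_germ_cong[of _ _ "x + 1"]) (use A in \<open>auto simp: G_def\<close>)
  have "integral_germ (\<lambda>t. Max ((\<lambda>a. case a of (k::int, b) \<Rightarrow> of_int k * - t + b) ` A)) (- x)"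
    using A integral_germ_affine[of "- _"] by (intro integral_germ_Max) auto
  then have "integral_germ (\<lambda>t. G (- t)) (- x)" by (simp add: G_def)
  then show "integral_germ (\<lambda>t. h (- t)) (- x)"
    by (rule integral_germ_cong') (use A in \<open>auto simp: G_def\<close>)
qed

lemma integral_pl_reflect: "integral_pl h \<Longrightarrow> integral_pl (\<lambda>t. h (- t))"
  unfolding integral_pl_def
proof (elim conjE, intro conjI allI)
  assume c: "convex_on UNIV h"
  show "convex_on UNIV (\<lambda>t. h (- t))"
  proof (intro convex_onI)
    fix t x y :: real assume "t > 0" "t < 1"
    then show "h (- ((1 - t) *\<^sub>R x + t *\<^sub>R y)) \<le> (1 - t) * h (- x) + t * h (- y)"
      using convex_onD[OF c, of t "- x" "- y"] by simp
  qed simp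
next
  fix x assume "\<forall>x. integral_germ h x \<and> integral_germ (\<lambda>t. h (- t)) (- x)"
  from this[rule_format, of "- x"]
  show "integral_germ (\<lambda>t. h (- t)) x" "integral_germ (\<lambda>t. h (- (- t))) (- x)" by auto
qed

text \<open>Both slopes are compared with the slope of the chord from \<open>x\<close> to
  \<open>q\<close>.\<close>

lemma convex_on_chord_slopes_le:
  fixes h :: "real \<Rightarrow> real"
  assumes c: "convex_on UNIV h" and x: "x < x'" "x' \<le> p" "p < q"
  shows "(h x' - h x) / (x' - x) \<le> (h q - h p) / (q - p)"
proof -
  have "(h x' - h x) / (x' - x) \<le> (h q - h x) / (q - x)"
    using convex_on_slope_le(1)[OF c _ _ x(1), of q] x
    by (smt (verit, best) UNIV_I minus_divide_divide)
  also have "\<dots> \<le> (h q - h p) / (q - p)"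
    using convex_on_slope_le(2)[OF c, of x q p] x
    by (smt (verit, best) UNIV_I minus_divide_divide)
  finally show ?thesis .
qed

text \<open>The right slope at \<open>p\<close> is an integer bounded by the chord slope over
  \<open>[p, p + e]\<close>, hence less than \<open>b + 1\<close> and so at most \<open>b\<close>.
  By convexity the slopes to the left of \<open>p\<close> are no larger. This rounding lets slope
  bounds survive perturbation.\<close>

lemma integral_pl_slope_le:
  assumes h: "integral_pl h" and e: "e > 0" "h (p + e) - h p < (of_int b + 1) * e"
    and x: "x \<le> x'" "x' \<le> p"
  shows "h x' - h x \<le> of_int b * (x' - x)"
proof -
  have c: "convex_on UNIV h" using h by (simp add: integral_pl_def)
  obtain k :: int where "\<forall>\<^sub>F t in at_right 0. h (p + t) = h p + of_int k * t"
    using h unfolding integral_pl_def integral_germ_def by blast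
  moreover have "\<forall>\<^sub>F t in at_right 0. 0 < t \<and> t < e"
    using e by (intro eventually_at_rightI[of 0 e]) auto
  ultimately have "\<forall>\<^sub>F t in at_right (0::real). h (p + t) = h p + of_int k * t \<and> 0 < t \<and> t < e"
    by eventually_elim auto
  then obtain t where t: "h (p + t) = h p + of_int k * t" "0 < t" "t < e"
    using eventually_happens trivial_limit_at_right_real by blast
  have kt: "(h (p + t) - h p) / (p + t - p) = of_int k"
    using t by simp
  have "of_int k \<le> (h (p + e) - h p) / e"
    using convex_on_slope_le(1)[OF c, of p "p + e" "p + t"] t
    by (smt (verit, best) UNIV_I minus_divide_divide kt add_diff_cancel_left')
  also have "\<dots> < of_int b + 1" using e by (simp add: divide_less_eq)
  finally have kb: "k \<le> b" by linarith
  show ?thesis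
  proof (cases "x = x'")
    case False
    then have "(h x' - h x) / (x' - x) \<le> of_int k"
      using convex_on_chord_slopes_le[OF c, of x x' p "p + t"] x t kt by simp
    then have "h x' - h x \<le> of_int k * (x' - x)"
      using False x by (simp add: divide_le_eq)
    also have "\<dots> \<le> of_int b * (x' - x)" using kb x by (intro mult_right_mono) auto
    finally show ?thesis .
  qed simp
qed

lemma integral_pl_slope_ge:
  assumes h: "integral_pl h" and e: "e > 0" "h p - h (p - e) > (of_int a - 1) * e"
    and x: "x \<le> x'" "p \<le> x"
  shows "h x' - h x \<ge> of_int a * (x' - x)"
  using integral_pl_slope_le[OF integral_pl_reflect[OF h] e(1), of "- p" "- a" "- x'" "- x"] e(2) x
  by (simp add: algebra_simps)


section \<open>Stability of slopes across slices, and joint continuity\<close>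

definition separately_integral_pl :: "(real \<times> real \<Rightarrow> real) \<Rightarrow> bool" where
  "separately_integral_pl f \<longleftrightarrow>
     (\<forall>y. integral_pl (\<lambda>x. f (x, y))) \<and> (\<forall>x. integral_pl (\<lambda>y. f (x, y)))"

lemma integral_germE:
  assumes "integral_germ h x"
  obtains k :: int and e where "e > 0" "\<And>t. 0 \<le> t \<Longrightarrow> t \<le> e \<Longrightarrow> h (x + t) = h x + of_int k * t"
proof -
  obtain k :: int where k: "\<forall>\<^sub>F t in at_right 0. h (x + t) = h x + of_int k * t"
    using assms unfolding integral_germ_def by blast
  then obtain d where d: "d > 0" "\<And>t. 0 < t \<Longrightarrow> t < d \<Longrightarrow> h (x + t) = h x + of_int k * t"
    unfolding eventually_at_right_field by auto
  have "h (x + t) = h x + of_int k * t" if "0 \<le> t" "t \<le> d / 2" for t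
    using d that by (cases "t = 0") auto
  with d(1) show thesis by (intro that[of "d / 2"]) auto
qed

lemma integral_plE:
  assumes "integral_pl h"
  obtains e and b a :: int where "e > 0"
    "\<And>t. 0 \<le> t \<Longrightarrow> t \<le> e \<Longrightarrow> h (x + t) = h x + of_int b * t"
    "\<And>t. 0 \<le> t \<Longrightarrow> t \<le> e \<Longrightarrow> h (x - t) = h x - of_int a * t"
proof -
  have g: "integral_germ h x" "integral_germ (\<lambda>t. h (- t)) (- x)"
    using assms unfolding integral_pl_def by auto
  obtain b e where b: "e > 0" "\<And>t. 0 \<le> t \<Longrightarrow> t \<le> e \<Longrightarrow> h (x + t) = h x + of_int b * t"
    using integral_germE[OF g(1)] by metis
  obtain a d where a: "d > 0" "\<And>t. 0 \<le> t \<Longrightarrow> t \<le> d \<Longrightarrow> h (- (- x + t)) = h (- (- x)) + of_int a * t"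
    using integral_germE[OF g(2)] by metis
  \<comment> \<open>The slope of the reflected function is minus the left slope of \<open>h\<close>,
    hence the witness \<open>- a\<close>.\<close>
  show thesis
    by (rule that[of "min e d" b "- a"]) (use a b in auto)
qed

lemma integral_pl_continuous: "integral_pl h \<Longrightarrow> continuous_on UNIV h"
  unfolding integral_pl_def by (intro convex_on_continuous) auto

lemma separately_integral_pl_continuous_snd:
  assumes "separately_integral_pl f"
  shows "((\<lambda>y. f (x, y)) \<longlongrightarrow> f (x, y0)) (at y0)"
proof -
  have "continuous_on UNIV (\<lambda>y. f (x, y))"
    using assms by (intro integral_pl_continuous) (auto simp: separately_integral_pl_def)
  then show ?thesis
    by (simp add: continuous_on_eq_continuous_at isCont_def)
qed

text \<open>
  For \<open>y\<close> near \<open>y0\<close> the difference quotients next to \<open>x0\<close> nearly lie between \<open>a\<close> and \<open>b\<close>,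
  and integrality of the slopes removes the error.
\<close>
lemma separately_integral_pl_slopes_stable:
  assumes f: "separately_integral_pl f" and e: "e > 0"
    and b: "\<And>t. 0 \<le> t \<Longrightarrow> t \<le> e \<Longrightarrow> f (x0 + t, y0) = f (x0, y0) + of_int b * t"
    and a: "\<And>t. 0 \<le> t \<Longrightarrow> t \<le> e \<Longrightarrow> f (x0 - t, y0) = f (x0, y0) - of_int a * t"
  obtains d where "d > 0"
    "\<And>x x' y. x0 - d \<le> x \<Longrightarrow> x \<le> x' \<Longrightarrow> x' \<le> x0 + d \<Longrightarrow> \<bar>y - y0\<bar> < d \<Longrightarrow>
       of_int a * (x' - x) \<le> f (x', y) - f (x, y) \<and> f (x', y) - f (x, y) \<le> of_int b * (x' - x)"
proof -
  note lim = separately_integral_pl_continuous_snd[OF f, of _ y0]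
  \<comment> \<open>The chords over \<open>[x0 + e / 2, x0 + e]\<close> and
    \<open>[x0 - e, x0 - e / 2]\<close> flank the interval on which the bounds are wanted. At
    \<open>y0\<close> their slopes are exactly \<open>b\<close> and \<open>a\<close>, so for nearby
    \<open>y\<close> they stay below \<open>b + 1\<close> and above \<open>a - 1\<close>.\<close>
  have "((\<lambda>y. f (x0 + e, y) - f (x0 + e / 2, y)) \<longlongrightarrow> f (x0 + e, y0) - f (x0 + e / 2, y0)) (at y0)"
    by (intro tendsto_intros lim)
  moreover have "f (x0 + e, y0) - f (x0 + e / 2, y0) < (of_int b + 1) * (e / 2)"
    using b[of e] b[of "e / 2"] e by (simp add: algebra_simps)
  ultimately have 1: "\<forall>\<^sub>F y in at y0. f (x0 + e, y) - f (x0 + e / 2, y) < (of_int b + 1) * (e / 2)"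
    by (rule order_tendstoD)
  have "((\<lambda>y. f (x0 - e / 2, y) - f (x0 - e, y)) \<longlongrightarrow> f (x0 - e / 2, y0) - f (x0 - e, y0)) (at y0)"
    by (intro tendsto_intros lim)
  moreover have "f (x0 - e / 2, y0) - f (x0 - e, y0) > (of_int a - 1) * (e / 2)"
    using a[of e] a[of "e / 2"] e by (simp add: field_simps)
  ultimately have 2: "\<forall>\<^sub>F y in at y0. f (x0 - e / 2, y) - f (x0 - e, y) > (of_int a - 1) * (e / 2)"
    by (rule order_tendstoD)
  obtain d where d: "d > 0" and bd: "\<And>y. y \<noteq> y0 \<Longrightarrow> \<bar>y - y0\<bar> < d \<Longrightarrow>
      f (x0 + e, y) - f (x0 + e / 2, y) < (of_int b + 1) * (e / 2) \<and>
      f (x0 - e / 2, y) - f (x0 - e, y) > (of_int a - 1) * (e / 2)"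
    using eventually_conj[OF 1 2] unfolding eventually_at by (auto simp: dist_real_def)
  \<comment> \<open>The filter \<open>at y0\<close> is punctured, so \<open>y0\<close> itself is
    treated separately.\<close>
  have at_y0: "f (x0 + e, y0) - f (x0 + e / 2, y0) < (of_int b + 1) * (e / 2) \<and>
      f (x0 - e / 2, y0) - f (x0 - e, y0) > (of_int a - 1) * (e / 2)"
    using a[of e] a[of "e / 2"] b[of e] b[of "e / 2"] e by (simp add: field_simps)
  show thesis
  proof (rule that[of "min d (e / 2)"])
    fix x x' y assume *: "x0 - min d (e / 2) \<le> x" "x \<le> x'" "x' \<le> x0 + min d (e / 2)"
      "\<bar>y - y0\<bar> < min d (e / 2)"
    have h: "integral_pl (\<lambda>x. f (x, y))" using f by (auto simp: separately_integral_pl_def)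
    have "f (x0 + e, y) - f (x0 + e / 2, y) < (of_int b + 1) * (e / 2) \<and>
        f (x0 - e / 2, y) - f (x0 - e, y) > (of_int a - 1) * (e / 2)"
    proof (cases "y = y0")
      case True
      then show ?thesis using at_y0 by simp
    next
      case False
      then show ?thesis using * by (intro bd) auto
    qed
    then have "f (x0 + e / 2 + e / 2, y) - f (x0 + e / 2, y) < (of_int b + 1) * (e / 2)"
        "f (x0 - e / 2, y) - f (x0 - e / 2 - e / 2, y) > (of_int a - 1) * (e / 2)"
      by (simp_all only: add.assoc diff_diff_eq field_sum_of_halves)
    then show "of_int a * (x' - x) \<le> f (x', y) - f (x, y) \<and> f (x', y) - f (x, y) \<le> of_int b * (x' - x)"
      using integral_pl_slope_le[OF h, of "e / 2" "x0 + e / 2" b x x']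
        integral_pl_slope_ge[OF h, of "e / 2" a "x0 - e / 2" x x'] * e by auto
  qed (use d e in auto)
qed

text \<open>Near \<open>(x0, y0)\<close> the horizontal slopes are bounded uniformly in
  \<open>y\<close>, so \<open>f q\<close> differs little from its value on the vertical line through
  \<open>x0\<close>, where \<open>f\<close> is continuous.\<close>

lemma separately_integral_pl_continuous:
  assumes f: "separately_integral_pl f"
  shows "continuous_on UNIV f"
  unfolding continuous_on_eq_continuous_at[OF open_UNIV]
proof
  fix p :: "real \<times> real"
  obtain x0 y0 where p: "p = (x0, y0)" by fastforce
  have "integral_pl (\<lambda>x. f (x, y0))" using f by (auto simp: separately_integral_pl_def)
  then obtain e and b a :: int where "e > 0"
    "\<And>t. 0 \<le> t \<Longrightarrow> t \<le> e \<Longrightarrow> f (x0 + t, y0) = f (x0, y0) + of_int b * t"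
    "\<And>t. 0 \<le> t \<Longrightarrow> t \<le> e \<Longrightarrow> f (x0 - t, y0) = f (x0, y0) - of_int a * t"
    by (rule integral_plE[where x = x0]) blast
  then obtain d where d: "d > 0"
    "\<And>x x' y. x0 - d \<le> x \<Longrightarrow> x \<le> x' \<Longrightarrow> x' \<le> x0 + d \<Longrightarrow> \<bar>y - y0\<bar> < d \<Longrightarrow>
       of_int a * (x' - x) \<le> f (x', y) - f (x, y) \<and> f (x', y) - f (x, y) \<le> of_int b * (x' - x)"
    using separately_integral_pl_slopes_stable[OF f] by metis
  define K :: real where "K = max \<bar>of_int a\<bar> \<bar>of_int b\<bar>"
  have bound: "norm (f q - f (x0, snd q)) \<le> K * \<bar>fst q - x0\<bar>" if "dist q p < d" for q
  proof -
    obtain x y where q: "q = (x, y)" by fastforce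
    have xy: "\<bar>x - x0\<bar> < d" "\<bar>y - y0\<bar> < d"
      using that dist_fst_le[of q p] dist_snd_le[of q p] by (auto simp: q p dist_real_def)
    have le: "of_int a * t \<ge> - (K * t)" "of_int b * t \<le> K * t" if "t \<ge> 0" for t
    proof -
      have "- K * t \<le> of_int a * t" using that by (intro mult_right_mono) (auto simp: K_def)
      then show "of_int a * t \<ge> - (K * t)" by simp
      show "of_int b * t \<le> K * t" using that by (intro mult_right_mono) (auto simp: K_def)
    qed
    show ?thesis
    proof (cases "x \<le> x0")
      case True
      then have "\<bar>x - x0\<bar> = x0 - x" by simp
      then show ?thesis unfolding q fst_conv snd_conv real_norm_def
        using d(2)[of x x0 y] xy le[of "x0 - x"] True d(1) by (smt (verit))
    next
      case False
      then have "\<bar>x - x0\<bar> = x - x0" by simp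
      then show ?thesis unfolding q fst_conv snd_conv real_norm_def
        using d(2)[of x0 x y] xy le[of "x - x0"] False d(1) by (smt (verit))
    qed
  qed
  have 1: "((\<lambda>q. f q - f (x0, snd q)) \<longlongrightarrow> 0) (at p)"
  proof (rule Lim_null_comparison)
    show "\<forall>\<^sub>F q in at p. norm (f q - f (x0, snd q)) \<le> K * \<bar>fst q - x0\<bar>"
      unfolding eventually_at
    proof (intro exI[of _ d] conjI ballI impI)
      fix q assume "q \<noteq> p \<and> dist q p < d"
      then show "norm (f q - f (x0, snd q)) \<le> K * \<bar>fst q - x0\<bar>" using bound by blast
    qed (fact d(1))
    have "isCont (\<lambda>q. K * \<bar>fst q - x0\<bar>) p" by (intro continuous_intros)
    then show "((\<lambda>q. K * \<bar>fst q - x0\<bar>) \<longlongrightarrow> 0) (at p)" by (simp add: isCont_def p)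
  qed
  have "continuous_on UNIV (\<lambda>y. f (x0, y))"
    using f by (intro integral_pl_continuous) (auto simp: separately_integral_pl_def)
  then have "continuous_on UNIV (\<lambda>q :: real \<times> real. f (x0, snd q))"
    by (rule continuous_on_compose2) (auto intro: continuous_intros)
  then have "isCont (\<lambda>q. f (x0, snd q)) p"
    unfolding continuous_on_eq_continuous_at[OF open_UNIV] by blast
  then have 2: "((\<lambda>q. f (x0, snd q)) \<longlongrightarrow> f (x0, snd p)) (at p)"
    by (simp only: isCont_def)
  show "isCont f p"
    using tendsto_add[OF 1 2] by (simp add: isCont_def p)
qed

section \<open>Smooth points and convexity of \<open>f\<close>\<close>

text \<open>With equal left and right slope \<open>a\<close>, stability squeezes the horizontal
  slopes on nearby lines to exactly \<open>a\<close>; the vertical slice through \<open>x\<close>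
  then fixes the values.\<close>

lemma separately_integral_pl_locally_affine:
  assumes f: "separately_integral_pl f" and e: "e > 0"
    and a: "\<And>u. \<bar>u\<bar> \<le> e \<Longrightarrow> f (x + u, y) = f (x, y) + of_int a * u"
    and b: "\<And>v. \<bar>v\<bar> \<le> e \<Longrightarrow> f (x, y + v) = f (x, y) + of_int b * v"
  obtains r where "r > 0"
    "\<And>u v. \<bar>u\<bar> < r \<Longrightarrow> \<bar>v\<bar> < r \<Longrightarrow> f (x + u, y + v) = f (x, y) + of_int a * u + of_int b * v"
proof -
  obtain d where d: "d > 0"
    "\<And>u u' w. x - d \<le> u \<Longrightarrow> u \<le> u' \<Longrightarrow> u' \<le> x + d \<Longrightarrow> \<bar>w - y\<bar> < d \<Longrightarrow>
       of_int a * (u' - u) \<le> f (u', w) - f (u, w) \<and> f (u', w) - f (u, w) \<le> of_int a * (u' - u)"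
    by (rule separately_integral_pl_slopes_stable[OF f e, of x y a a]) (use a a[of "- _"] in auto)
  show thesis
  proof (rule that[of "min d e"])
    fix u v assume uv: "\<bar>u\<bar> < min d e" "\<bar>v\<bar> < min d e"
    have "f (x + u, y + v) = f (x, y + v) + of_int a * u"
      using d(2)[of x "x + u" "y + v"] d(2)[of "x + u" x "y + v"] uv
      by (cases "u \<ge> 0") auto
    then show "f (x + u, y + v) = f (x, y) + of_int a * u + of_int b * v"
      using b[of v] uv by simp
  qed (use d e in auto)
qed

text \<open>Dividing the bound by \<open>t\<close> and letting \<open>t\<close> tend to 0 gives
  right slope \<le> \<open>c\<close> \<le> left slope. Convexity gives the reverse order, so there
  is no kink at \<open>x\<close>.\<close>

lemma integral_pl_affine_if_touched_above:
  assumes h: "integral_pl h" and r: "r > 0"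
    and q: "\<And>t. \<bar>t\<bar> < r \<Longrightarrow> h (x + t) \<le> h x + c * t + K * t\<^sup>2"
  shows "\<exists>k::int. \<exists>e>0. \<forall>t. \<bar>t\<bar> \<le> e \<longrightarrow> h (x + t) = h x + of_int k * t"
proof -
  obtain e and b a :: int where e: "e > 0"
    and b: "\<And>t. 0 \<le> t \<Longrightarrow> t \<le> e \<Longrightarrow> h (x + t) = h x + of_int b * t"
    and a: "\<And>t. 0 \<le> t \<Longrightarrow> t \<le> e \<Longrightarrow> h (x - t) = h x - of_int a * t"
    by (rule integral_plE[OF h, where x = x]) blast
  have ev: "\<forall>\<^sub>F t in at_right 0. 0 < t \<and> t < min e r"
    using e r by (intro eventually_at_rightI[of 0 "min e r"]) auto
  have "of_int b \<le> c"
  proof (rule tendsto_lowerbound)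
    show "((\<lambda>t. c + K * t) \<longlongrightarrow> c) (at_right 0)" by (auto intro!: tendsto_eq_intros)
    show "\<forall>\<^sub>F t in at_right 0. of_int b \<le> c + K * t"
      using ev
    proof eventually_elim
      fix t assume t: "0 < t \<and> t < min e r"
      then have "of_int b * t \<le> (c + K * t) * t"
        using b[of t] q[of t] by (simp add: algebra_simps power2_eq_square)
      then show "of_int b \<le> c + K * t" using t by simp
    qed
  qed simp
  moreover have "c \<le> of_int a"
  proof (rule tendsto_upperbound)
    show "((\<lambda>t. c - K * t) \<longlongrightarrow> c) (at_right 0)" by (auto intro!: tendsto_eq_intros)
    show "\<forall>\<^sub>F t in at_right 0. c - K * t \<le> of_int a"
      using ev
    proof eventually_elim
      fix t assume t: "0 < t \<and> t < min e r"
      then have "(c - K * t) * t \<le> of_int a * t"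
        using a[of t] q[of "- t"] by (simp add: algebra_simps power2_eq_square)
      then show "c - K * t \<le> of_int a" using t by simp
    qed
  qed simp
  moreover have "a \<le> b"
  proof -
    have "convex_on UNIV h" using h by (simp add: integral_pl_def)
    from convex_onD[OF this, of "1 / 2" "x - e" "x + e"]
    have "h x \<le> (h (x - e) + h (x + e)) / 2" by (simp add: field_simps)
    then have "of_int a * e \<le> of_int b * e" using a[of e] b[of e] e by simp
    then show ?thesis using e by simp
  qed
  ultimately have "a = b" by linarith
  show ?thesis
  proof (intro exI[of _ b] exI[of _ e] conjI allI impI)
    fix t assume "\<bar>t\<bar> \<le> e"
    then show "h (x + t) = h x + of_int b * t"
      using b[of t] a[of "- t"] \<open>a = b\<close> by (cases "t \<ge> 0") auto
  qed (fact e)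
qed

text \<open>
  The slices through the point of contact are touched from above by a smooth function, so their
  kinks there vanish and \<open>f\<close> is affine nearby, which contradicts the concave term \<open>- \<eta> s\<^sup>2\<close>.
\<close>
lemma separately_integral_pl_not_touched_above:
  assumes f: "separately_integral_pl f" and d: "(d1, d2) \<noteq> (0, 0)" and eta: "\<eta> > 0" and r: "r > 0"
    and q: "\<And>s t. \<bar>s\<bar> < r \<Longrightarrow> \<bar>t\<bar> < r \<Longrightarrow>
      f (x + s * d1 - t * d2, y + s * d2 + t * d1) \<le> f (x, y) + c1 * s + c2 * t - \<eta> * s\<^sup>2 + N * t\<^sup>2"
  shows False
proof -
  \<comment> \<open>The axis directions correspond to \<open>(s, t) = (d1, - d2) / D\<close> and \<open>(d2, d1) / D\<close>.\<close>
  define D where "D = d1\<^sup>2 + d2\<^sup>2"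
  have D: "D > 0" using d unfolding D_def by (simp add: sum_power2_gt_zero_iff)
  \<comment> \<open>On the line \<open>(s, t) = u * (m, n)\<close> the bound becomes a quadratic in
    \<open>u\<close>; the radius keeps both coordinates below \<open>r\<close>.\<close>
  have line: "f (x + u * (m * d1 - n * d2), y + u * (m * d2 + n * d1)) \<le>
      f (x, y) + (c1 * m + c2 * n) * u + (N * n\<^sup>2 - \<eta> * m\<^sup>2) * u\<^sup>2"
    if "\<bar>u\<bar> < r / (\<bar>m\<bar> + \<bar>n\<bar> + 1)" for m n u
  proof -
    have "\<bar>u\<bar> * (\<bar>m\<bar> + \<bar>n\<bar> + 1) < r" using that by (simp add: less_divide_eq)
    moreover have "\<bar>u * m\<bar> \<le> \<bar>u\<bar> * (\<bar>m\<bar> + \<bar>n\<bar> + 1)" "\<bar>u * n\<bar> \<le> \<bar>u\<bar> * (\<bar>m\<bar> + \<bar>n\<bar> + 1)"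
      unfolding abs_mult by (intro mult_left_mono; simp)+
    ultimately have "\<bar>u * m\<bar> < r" "\<bar>u * n\<bar> < r" by linarith+
    from q[OF this] show ?thesis by (simp add: algebra_simps power2_eq_square)
  qed
  have h: "integral_pl (\<lambda>x. f (x, y))" "integral_pl (\<lambda>y. f (x, y))"
    using f by (auto simp: separately_integral_pl_def)
  have D1: "d1 / D * d1 - (- d2 / D) * d2 = 1" "d1 / D * d2 + (- d2 / D) * d1 = 0"
    "d2 / D * d1 - (d1 / D) * d2 = 0" "d2 / D * d2 + (d1 / D) * d1 = 1"
    using D by (auto simp: D_def power2_eq_square simp flip: add_divide_distrib)
  have r': "r / (\<bar>m\<bar> + \<bar>n\<bar> + 1) > 0" for m n :: real
    using r by (intro divide_pos_pos) auto
  have "\<exists>a::int. \<exists>e1>0. \<forall>t. \<bar>t\<bar> \<le> e1 \<longrightarrow> f (x + t, y) = f (x, y) + of_int a * t"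
    by (rule integral_pl_affine_if_touched_above[OF h(1) r'
          line[of _ "d1 / D" "- d2 / D", unfolded D1 mult_1_right mult_zero_right add_0_right]])
  then obtain a :: int and e1 where a: "e1 > 0" "\<And>t. \<bar>t\<bar> \<le> e1 \<Longrightarrow> f (x + t, y) = f (x, y) + of_int a * t"
    by blast
  have "\<exists>b::int. \<exists>e2>0. \<forall>t. \<bar>t\<bar> \<le> e2 \<longrightarrow> f (x, y + t) = f (x, y) + of_int b * t"
    by (rule integral_pl_affine_if_touched_above[OF h(2) r'
          line[of _ "d2 / D" "d1 / D", unfolded D1 mult_1_right mult_zero_right add_0_right]])
  then obtain b :: int and e2 where b: "e2 > 0" "\<And>t. \<bar>t\<bar> \<le> e2 \<Longrightarrow> f (x, y + t) = f (x, y) + of_int b * t"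
    by blast
  obtain \<rho> where rho: "\<rho> > 0" "\<And>u v. \<bar>u\<bar> < \<rho> \<Longrightarrow> \<bar>v\<bar> < \<rho> \<Longrightarrow>
      f (x + u, y + v) = f (x, y) + of_int a * u + of_int b * v"
    by (rule separately_integral_pl_locally_affine[OF f, of "min e1 e2" x y a b]) (use a b in auto)
  define u where "u = min (r / 2) (\<rho> / (\<bar>d1\<bar> + \<bar>d2\<bar> + 1) / 2)"
  have u: "u > 0" "u < r" unfolding u_def using r rho by (auto intro!: divide_pos_pos)
  have half_less_self: "x / 2 < x" if "0 < x" for x :: real using that by simp
  have "\<rho> / (\<bar>d1\<bar> + \<bar>d2\<bar> + 1) > 0" using rho(1) by (intro divide_pos_pos) auto
  then have "u < \<rho> / (\<bar>d1\<bar> + \<bar>d2\<bar> + 1)"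
    unfolding u_def by (intro le_less_trans[OF min.cobounded2]) (simp only: half_less_self)
  then have "u * (\<bar>d1\<bar> + \<bar>d2\<bar> + 1) < \<rho>" by (simp add: less_divide_eq)
  moreover have "\<bar>u * d1\<bar> \<le> u * (\<bar>d1\<bar> + \<bar>d2\<bar> + 1)" "\<bar>u * d2\<bar> \<le> u * (\<bar>d1\<bar> + \<bar>d2\<bar> + 1)"
    unfolding abs_mult using u(1) by (auto intro!: mult_left_mono)
  ultimately have ud: "\<bar>u * d1\<bar> < \<rho>" "\<bar>u * d2\<bar> < \<rho>" by linarith+
  \<comment> \<open>Adding the bounds at \<open>(s, t) = (u, 0)\<close> and \<open>(- u, 0)\<close>
    cancels all linear terms and leaves \<open>0 \<le> - 2 * \<eta> * u\<^sup>2\<close>.\<close>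
  have "of_int a * (u * d1) + of_int b * (u * d2) \<le> c1 * u - \<eta> * u\<^sup>2"
    using q[of u 0] rho(2)[OF ud] u r by simp
  moreover have "- (of_int a * (u * d1) + of_int b * (u * d2)) \<le> - c1 * u - \<eta> * u\<^sup>2"
    using q[of "- u" 0] rho(2)[of "- (u * d1)" "- (u * d2)"] ud u r by simp
  moreover have "\<eta> * u\<^sup>2 > 0" using eta u by simp
  ultimately show False by linarith
qed


text \<open>
  If \<open>f\<close> exceeded a chord, then subtracting the affine interpolation and a small concave
  quadratic along the chord and penalizing the distance from the chord would give a function
  with a maximum in the interior of a thin rectangle around it.
\<close>
lemma separately_integral_pl_convex:
  assumes f: "separately_integral_pl f"
  shows "convex_on UNIV f"
proof (intro convex_onI)
  fix s0 :: real and A B :: "real \<times> real"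
  assume s0: "s0 > 0" "s0 < 1"
  show "f ((1 - s0) *\<^sub>R A + s0 *\<^sub>R B) \<le> (1 - s0) * f A + s0 * f B"
  proof (rule ccontr)
    assume neg: "\<not> ?thesis"
    obtain a1 a2 b1 b2 where AB: "A = (a1, a2)" "B = (b1, b2)" by fastforce
    define d1 d2 where d: "d1 = b1 - a1" "d2 = b2 - a2"
    \<comment> \<open>Orthogonal coordinates: \<open>s\<close> runs along the chord from
      \<open>A\<close> at 0 to \<open>B\<close> at 1, and \<open>t\<close> runs across it.\<close>
    define E where "E s t = (a1 + s * d1 - t * d2, a2 + s * d2 + t * d1)" for s t
    define G where "G = f (E s0 0) - ((1 - s0) * f A + s0 * f B)"
    have "E s0 0 = (1 - s0) *\<^sub>R A + s0 *\<^sub>R B" by (simp add: E_def AB d algebra_simps)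
    then have G: "G > 0" using neg by (simp add: G_def)
    have d0: "(d1, d2) \<noteq> (0, 0)"
    proof
      assume "(d1, d2) = (0, 0)"
      then have "E s0 0 = A" "B = A" by (auto simp: E_def AB d)
      then show False using G by (simp add: G_def algebra_simps)
    qed
    \<comment> \<open>As \<open>s0 * (1 - s0) \<le> 1\<close>, subtracting the quadratic bump leaves
      at least \<open>G / 2\<close> at \<open>(s0, 0)\<close>.\<close>
    define \<eta> where "\<eta> = G / 2"
    define \<psi> where "\<psi> z = f (E (fst z) (snd z)) - (1 - fst z) * f A - fst z * f B - \<eta> * (fst z * (1 - fst z))" for z
    note cf = continuous_on_compose2[OF separately_integral_pl_continuous[OF f]]
    have cont: "continuous_on UNIV \<psi>"
      unfolding \<psi>_def E_def by (intro continuous_intros cf) auto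
    \<comment> \<open>Since \<open>\<psi>\<close> vanishes at both ends of the chord, continuity
      keeps it below \<open>G / 2\<close> on the short sides of a thin enough rectangle.\<close>
    have ends: "\<psi> (0, 0) = 0" "\<psi> (1, 0) = 0"
      by (auto simp: \<psi>_def E_def AB d)
    have "\<forall>\<^sub>F t in at 0. \<psi> (s, t) < G / 2" if "s = 0 \<or> s = 1" for s
    proof -
      have "continuous_on UNIV (\<lambda>t. \<psi> (s, t))"
        by (intro continuous_on_compose2[OF cont] continuous_intros) auto
      then have "((\<lambda>t. \<psi> (s, t)) \<longlongrightarrow> \<psi> (s, 0)) (at 0)"
        by (simp add: continuous_on_eq_continuous_at isCont_def)
      then show ?thesis using G ends that by (intro order_tendstoD(2)) auto
    qed
    from eventually_conj[OF this[of 0] this[of 1]]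
    obtain \<delta>0 where d00: "\<delta>0 > 0" and
      d01: "\<And>t. t \<noteq> 0 \<Longrightarrow> \<bar>t\<bar> < \<delta>0 \<Longrightarrow> \<psi> (0, t) < G / 2 \<and> \<psi> (1, t) < G / 2"
      unfolding eventually_at by (auto simp: dist_real_def)
    define \<delta> where "\<delta> = \<delta>0 / 2"
    have \<delta>: "\<delta> > 0" "\<And>t. \<bar>t\<bar> \<le> \<delta> \<Longrightarrow> \<psi> (0, t) < G / 2 \<and> \<psi> (1, t) < G / 2"
      subgoal using d00 by (simp add: \<delta>_def)
      subgoal for t using d00 d01[of t] G ends by (cases "t = 0") (auto simp: \<delta>_def)
      done
    define R where "R = {0..1::real} \<times> {-\<delta>..\<delta>}"
    have R: "compact R" "(s0, 0) \<in> R"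
      unfolding R_def using s0 \<delta> by (auto intro: compact_Times)
    obtain zm where zm: "\<And>z. z \<in> R \<Longrightarrow> \<psi> z \<le> \<psi> zm"
      using continuous_attains_sup[OF R(1) _ continuous_on_subset[OF cont]] R(2) by (metis empty_iff subset_UNIV)
    \<comment> \<open>On the long sides \<open>\<bar>t\<bar> = \<delta>\<close> the penalty equals
      \<open>\<bar>\<psi> zm\<bar>\<close>, which is at least the maximum of \<open>\<psi>\<close>
      on \<open>R\<close>, so \<open>\<phi> \<le> 0\<close> there.\<close>
    define N where "N = \<bar>\<psi> zm\<bar> / \<delta>\<^sup>2"
    define \<phi> where "\<phi> z = \<psi> z - N * (snd z)\<^sup>2" for z
    have "continuous_on UNIV \<phi>" unfolding \<phi>_def by (intro continuous_intros cont)
    then obtain z where z: "z \<in> R" "\<And>w. w \<in> R \<Longrightarrow> \<phi> w \<le> \<phi> z"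
      using continuous_attains_sup[OF R(1) _ continuous_on_subset] R(2) by (metis empty_iff subset_UNIV)
    obtain s t where st: "z = (s, t)" by fastforce
    have "s0 * (1 - s0) \<le> 1 * 1" using s0 by (intro mult_mono) auto
    then have "G / 2 * (s0 * (1 - s0)) \<le> G / 2 * 1" using G by (intro mult_left_mono) auto
    moreover have "\<phi> (s0, 0) = G - G / 2 * (s0 * (1 - s0))"
      unfolding \<phi>_def \<psi>_def \<eta>_def fst_conv snd_conv by (simp add: G_def)
    ultimately have "G / 2 \<le> \<phi> (s0, 0)" by simp
    also have "\<dots> \<le> \<phi> z" using z R by auto
    finally have zG: "G / 2 \<le> \<phi> (s, t)" by (simp add: st)
    have N: "N \<ge> 0" by (simp add: N_def)
    have "\<phi> (s, t) \<le> \<psi> (s, t)" using N by (simp add: \<phi>_def)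
    then have "s \<noteq> 0" "s \<noteq> 1"
      using zG \<delta>(2)[of t] z(1) by (auto simp: st R_def abs_le_iff)
    moreover have "\<bar>t\<bar> \<noteq> \<delta>"
    proof
      assume "\<bar>t\<bar> = \<delta>"
      then have "N * t\<^sup>2 = \<bar>\<psi> zm\<bar>" using \<delta>(1) by (auto simp: N_def abs_if split: if_splits)
      then show False using zm[OF z(1)] zG G by (simp add: \<phi>_def st)
    qed
    ultimately have int: "0 < s" "s < 1" "- \<delta> < t" "t < \<delta>" using z(1) by (auto simp: st R_def)
    define \<rho> where "\<rho> = min (min s (1 - s)) (min (t + \<delta>) (\<delta> - t))"
    have \<rho>: "\<rho> > 0" using int by (simp add: \<rho>_def)
    show False
    proof (rule separately_integral_pl_not_touched_above[OF f d0 _ \<rho>])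
      fix s' t' assume "\<bar>s'\<bar> < \<rho>" "\<bar>t'\<bar> < \<rho>"
      then have "(s + s', t + t') \<in> R" by (auto simp: R_def \<rho>_def)
      from z(2)[OF this] have "\<psi> (s + s', t + t') - N * (t + t')\<^sup>2 \<le> \<psi> (s, t) - N * t\<^sup>2"
        by (simp add: \<phi>_def st)
      \<comment> \<open>Maximality of \<open>\<phi>\<close> at \<open>(s, t)\<close> is solved for
        \<open>f\<close>, with the bump and the penalty expanded about \<open>(s, t)\<close>; the
        bump contributes the concave term \<open>- \<eta> * s'\<^sup>2\<close>.\<close>
      then have "f (E (s + s') (t + t')) \<le> f (E s t) + (f B - f A + \<eta> * (1 - 2 * s)) * s'
          + (2 * N * t) * t' - \<eta> * s'\<^sup>2 + N * t'\<^sup>2"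
        by (simp add: \<psi>_def algebra_simps power2_eq_square)
      then show "f ((a1 + s * d1 - t * d2) + s' * d1 - t' * d2, (a2 + s * d2 + t * d1) + s' * d2 + t' * d1)
        \<le> f (a1 + s * d1 - t * d2, a2 + s * d2 + t * d1) + (f B - f A + \<eta> * (1 - 2 * s)) * s'
          + (2 * N * t) * t' - \<eta> * s'\<^sup>2 + N * t'\<^sup>2"
        by (simp add: E_def algebra_simps)
    qed (use G in \<open>simp add: \<eta>_def\<close>)
  qed
qed simp

section \<open>Integral supporting functionals\<close>

text \<open>The point \<open>x'\<close> is taken inside the affine piece that starts at
  \<open>x\<close> and goes right.\<close>

lemma integral_pl_affine_nearby:
  assumes h: "integral_pl h" and d: "d > 0"
  shows "\<exists>(k::int) x' e. \<bar>x' - x\<bar> < d \<and> e > 0 \<and>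
    (\<forall>t. \<bar>t\<bar> \<le> e \<longrightarrow> h (x' + t) = h x' + of_int k * t)"
proof -
  obtain e and b a :: int where e: "e > 0"
    and b: "\<And>t. 0 \<le> t \<Longrightarrow> t \<le> e \<Longrightarrow> h (x + t) = h x + of_int b * t"
    and "\<And>t. 0 \<le> t \<Longrightarrow> t \<le> e \<Longrightarrow> h (x - t) = h x - of_int a * t"
    by (rule integral_plE[OF h, where x = x]) blast
  define m where "m = min d e / 2"
  show ?thesis
  proof (rule exI[of _ b], rule exI[of _ "x + m"], rule exI[of _ m], intro conjI allI impI)
    fix t assume "\<bar>t\<bar> \<le> m"
    then show "h (x + m + t) = h (x + m) + of_int b * t"
      using b[of "m + t"] b[of m] e d by (auto simp: m_def algebra_simps)
  qed (use e d in \<open>auto simp: m_def\<close>)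
qed

text \<open>The pair \<open>(a, b)\<close> is an integral subgradient of \<open>f\<close> at
  \<open>p\<close>.\<close>

definition integral_support :: "(real \<times> real \<Rightarrow> real) \<Rightarrow> int \<Rightarrow> int \<Rightarrow> real \<times> real \<Rightarrow> bool" where
  "integral_support f a b p \<longleftrightarrow>
     (\<forall>x y. f (x, y) \<ge> f p + of_int a * (x - fst p) + of_int b * (y - snd p))"

text \<open>First \<open>x\<close> is moved to a smooth point of the horizontal slice, which stays
  smooth on nearby lines; then \<open>y\<close> is moved to a smooth point of the vertical slice
  through \<open>x'\<close>, within that range. There \<open>f\<close> is locally affine, and
  convexity turns the local functional into a global support.\<close>

lemma separately_integral_pl_dense_support:
  assumes f: "separately_integral_pl f" and d: "d > 0"
  shows "\<exists>x' y' a b. \<bar>x' - x\<bar> < d \<and> \<bar>y' - y\<bar> < d \<and> integral_support f a b (x', y')"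
proof -
  have h: "integral_pl (\<lambda>x. f (x, y))" "\<And>x. integral_pl (\<lambda>y. f (x, y))"
    using f by (auto simp: separately_integral_pl_def)
  obtain a :: int and x' e where a: "\<bar>x' - x\<bar> < d" "e > 0"
    "\<And>t. \<bar>t\<bar> \<le> e \<Longrightarrow> f (x' + t, y) = f (x', y) + of_int a * t"
    using integral_pl_affine_nearby[OF h(1) d, of x] by blast
  obtain r where r: "r > 0" "\<And>u u' w. x' - r \<le> u \<Longrightarrow> u \<le> u' \<Longrightarrow> u' \<le> x' + r \<Longrightarrow> \<bar>w - y\<bar> < r \<Longrightarrow>
       of_int a * (u' - u) \<le> f (u', w) - f (u, w) \<and> f (u', w) - f (u, w) \<le> of_int a * (u' - u)"
    by (rule separately_integral_pl_slopes_stable[OF f a(2), of x' y a a])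
       (use a(2) a(3) a(3)[of "- _"] in auto)
  obtain b :: int and y' e' where b: "\<bar>y' - y\<bar> < min d r" "e' > 0"
    "\<And>t. \<bar>t\<bar> \<le> e' \<Longrightarrow> f (x', y' + t) = f (x', y') + of_int b * t"
    using integral_pl_affine_nearby[OF h(2), of "min d r" y x'] d r(1) unfolding min_less_iff_conj by blast
  have slice: "f (x' + u, y') = f (x', y') + of_int a * u" if "\<bar>u\<bar> \<le> r" for u
    using r(2)[of x' "x' + u" y'] r(2)[of "x' + u" x' y'] b that by (cases "u \<ge> 0") auto
  obtain \<rho> where \<rho>: "\<rho> > 0" "\<And>u v. \<bar>u\<bar> < \<rho> \<Longrightarrow> \<bar>v\<bar> < \<rho> \<Longrightarrow>
      f (x' + u, y' + v) = f (x', y') + of_int a * u + of_int b * v"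
    by (rule separately_integral_pl_locally_affine[OF f, of "min r e'" x' y' a b])
      (use r b slice in auto)
  have "integral_support f a b (x', y')"
    unfolding integral_support_def
  proof (intro allI)
    fix u v
    define m where "m = \<bar>u - x'\<bar> + \<bar>v - y'\<bar> + \<rho>"
    \<comment> \<open>The factor \<open>s\<close> pulls \<open>(u, v)\<close> towards
      \<open>(x', y')\<close> into the square where \<open>f\<close> is affine; convexity along the
      segment carries the inequality back.\<close>
    define s where "s = \<rho> / (2 * m)"
    have m: "m > 0" "m \<ge> \<rho>" using \<rho>(1) by (auto simp: m_def)
    have s: "0 < s" "s \<le> 1" unfolding s_def using m \<rho>(1) by (auto simp: field_simps)
    have "\<bar>s * (u - x')\<bar> \<le> s * m" "\<bar>s * (v - y')\<bar> \<le> s * m"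
      unfolding abs_mult using s \<rho>(1) by (auto simp: m_def intro!: mult_left_mono)
    moreover have "s * m = \<rho> / 2" using m by (simp add: s_def)
    ultimately have small: "\<bar>s * (u - x')\<bar> < \<rho>" "\<bar>s * (v - y')\<bar> < \<rho>" using \<rho>(1) by auto
    have "f (x' + s * (u - x'), y' + s * (v - y')) \<le> (1 - s) * f (x', y') + s * f (u, v)"
      using convex_onD[OF separately_integral_pl_convex[OF f], of s "(x', y')" "(u, v)"] s
      by (simp add: algebra_simps)
    then have "s * (f (x', y') + of_int a * (u - x') + of_int b * (v - y')) \<le> s * f (u, v)"
      using \<rho>(2)[OF small] by (simp add: algebra_simps)
    then show "f (u, v) \<ge> f (x', y') + of_int a * (u - fst (x', y')) + of_int b * (v - snd (x', y'))"
      using s by simp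
  qed
  then show ?thesis using a b by (intro exI[of _ x'] exI[of _ y'] exI[of _ a] exI[of _ b]) auto
qed

section \<open>Finitely many slopes from linear growth\<close>

lemma linear_growth_slope_le:
  fixes m :: real
  assumes "\<And>t. t \<ge> 0 \<Longrightarrow> c + m * t \<le> C * (1 + t)"
  shows "m \<le> C"
proof (rule ccontr)
  assume "\<not> m \<le> C"
  then have mC: "m - C > 0" by simp
  define t where "t = (\<bar>C\<bar> + \<bar>c\<bar> + 1) / (m - C)"
  have "(m - C) * t = \<bar>C\<bar> + \<bar>c\<bar> + 1" using mC by (simp add: t_def)
  moreover have "t \<ge> 0" using mC by (simp add: t_def)
  then have "c + m * t \<le> C + C * t" using assms[of t] by (simp add: distrib_left)
  ultimately show False by (simp add: left_diff_distrib)
qed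

text \<open>Along the three rays a support with slopes \<open>(a, b)\<close> grows at rates
  \<open>- a\<close>, \<open>- b\<close> and \<open>a + b\<close>, so all three are at most
  \<open>C\<close>. This confines the integral slopes to a finite set, and one functional per slope
  pair suffices.\<close>

lemma transintegral_polyhedral_if_growth:
  assumes f: "separately_integral_pl f"
    and g: "\<And>t. t \<ge> 0 \<Longrightarrow> f (- t, 0) \<le> C * (1 + t)" "\<And>t. t \<ge> 0 \<Longrightarrow> f (0, - t) \<le> C * (1 + t)"
      "\<And>t. t \<ge> 0 \<Longrightarrow> f (t, t) \<le> C * (1 + t)"
  shows "transintegral_polyhedral_on UNIV f"
proof -
  define S where "S = {(a, b). \<exists>p. integral_support f a b p}"
  have bd: "- of_int a \<le> C \<and> - of_int b \<le> C \<and> of_int a + of_int b \<le> C" if "(a, b) \<in> S" for a b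
  proof -
    from that obtain p where "integral_support f a b p" unfolding S_def by blast
    then have p: "\<And>x y. f p + of_int a * (x - fst p) + of_int b * (y - snd p) \<le> f (x, y)"
      unfolding integral_support_def by blast
    define c where "c = f p - of_int a * fst p - of_int b * snd p"
    have "c + (- of_int a) * t \<le> C * (1 + t)" "c + (- of_int b) * t \<le> C * (1 + t)"
      "c + (of_int a + of_int b) * t \<le> C * (1 + t)" if "t \<ge> 0" for t
      using p[of "- t" 0] p[of 0 "- t"] p[of t t] g[OF that] by (auto simp: c_def algebra_simps)
    then show ?thesis using linear_growth_slope_le by blast
  qed
  \<comment> \<open>The upper bound comes from \<open>a = (a + b) - b \<le> 2 * C\<close>, and
    likewise for \<open>b\<close>.\<close>
  have "S \<subseteq> {- \<lceil>C\<rceil> .. 2 * \<lceil>C\<rceil>} \<times> {- \<lceil>C\<rceil> .. 2 * \<lceil>C\<rceil>}"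
  proof (rule subrelI)
    fix a b assume "(a, b) \<in> S"
    from bd[OF this] show "(a, b) \<in> {- \<lceil>C\<rceil> .. 2 * \<lceil>C\<rceil>} \<times> {- \<lceil>C\<rceil> .. 2 * \<lceil>C\<rceil>}"
      by simp linarith
  qed
  then have fin: "finite S" by (rule finite_subset) auto
  define q where "q ab = (SOME p. integral_support f (fst ab) (snd ab) p)" for ab
  define L where "L ab z = f (q ab) + of_int (fst ab) * (fst z - fst (q ab)) + of_int (snd ab) * (snd z - snd (q ab))"
    for ab z
  have q: "integral_support f a b (q (a, b))" if "(a, b) \<in> S" for a b
    using that unfolding S_def q_def by (auto intro: someI)
  have L_le: "L ab z \<le> f z" if "ab \<in> S" for ab z
    using q[of "fst ab" "snd ab"] that unfolding integral_support_def L_def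
    by (metis prod.collapse)
  \<comment> \<open>Two functionals with the same slopes that both touch \<open>f\<close> from below
    coincide, so the base point chosen by \<open>q\<close> is immaterial.\<close>
  have L_eq: "L (a, b) p = f p" if "integral_support f a b p" for a b p
  proof -
    have "(a, b) \<in> S" using that unfolding S_def by blast
    then have "f p \<ge> L (a, b) p" by (rule L_le)
    moreover have "f (q (a, b)) \<ge> f p + of_int a * (fst (q (a, b)) - fst p) + of_int b * (snd (q (a, b)) - snd p)"
      using that unfolding integral_support_def by (metis prod.collapse)
    ultimately show ?thesis by (simp add: L_def algebra_simps)
  qed
  \<comment> \<open>The set where some functional touches \<open>f\<close> is closed, as a finite
    union of closed sets, and dense, hence the whole plane.\<close>
  define T where "T = (\<Union>ab\<in>S. {z. L ab z = f z})"
  have "closed {z. L ab z = f z}" for ab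
    unfolding L_def
    by (intro closed_Collect_eq continuous_intros separately_integral_pl_continuous[OF f])
  then have "closed T"
    unfolding T_def using fin by (intro closed_UN) auto
  moreover have "z \<in> closure T" for z
    unfolding closure_approachable
  proof (intro allI impI)
    fix e :: real assume e: "e > 0"
    obtain x y where z: "z = (x, y)" by fastforce
    obtain x' y' a b where *: "\<bar>x' - x\<bar> < e / 2" "\<bar>y' - y\<bar> < e / 2" "integral_support f a b (x', y')"
      using separately_integral_pl_dense_support[OF f, of "e / 2" x y] e by auto
    have "(x', y') \<in> T" using *(3) L_eq unfolding T_def S_def by blast
    moreover have "dist (x', y') z \<le> \<bar>x' - x\<bar> + \<bar>y' - y\<bar>"
      unfolding z dist_Pair_Pair dist_real_def by (intro order_trans[OF sqrt_sum_squares_le_sum_abs]) auto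
    ultimately show "\<exists>w\<in>T. dist w z < e" using * by (intro bexI[of _ "(x', y')"]) auto
  qed
  ultimately have T: "z \<in> T" for z by (simp add: closure_closed)
  then have "S \<noteq> {}" by (auto simp: T_def)
  obtain ss where ss: "set ss = S" using finite_list[OF fin] by auto
  have "transintegral_affine (L ab)" for ab
    unfolding transintegral_affine_def L_def
    by (rule exI[of _ "fst ab"], rule exI[of _ "snd ab"],
        rule exI[of _ "f (q ab) - of_int (fst ab) * fst (q ab) - of_int (snd ab) * snd (q ab)"])
       (simp add: algebra_simps)
  moreover have "f z = Max ((\<lambda>l. l z) ` set (map L ss))" for z
  proof (rule Max_eqI[symmetric])
    show "w \<le> f z" if "w \<in> (\<lambda>l. l z) ` set (map L ss)" for w
      using that L_le unfolding set_map image_image ss by blast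
    show "f z \<in> (\<lambda>l. l z) ` set (map L ss)"
    proof -
      obtain ab where "ab \<in> S" "L ab z = f z" using T[of z] unfolding T_def by blast
      then show ?thesis unfolding set_map image_image ss by (metis image_eqI)
    qed
  qed simp
  ultimately show ?thesis
    unfolding transintegral_polyhedral_on_def using \<open>S \<noteq> {}\<close> ss
    by (intro exI[of _ "map L ss"]) auto
qed

section \<open>From restrictions to slices and growth bounds, and the equivalences\<close>

lemma transintegral_polyhedral_on_subset:
  "transintegral_polyhedral_on T f \<Longrightarrow> S \<subseteq> T \<Longrightarrow> transintegral_polyhedral_on S f"
  unfolding transintegral_polyhedral_on_def by (meson subsetD)

text \<open>An integer direction \<open>(m, n)\<close> turns integral coefficients into the integral
  slope \<open>a1 * m + a2 * n\<close>. Stopping at \<open>X\<close> covers lines and tripod legs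
  alike.\<close>

lemma transintegral_polyhedral_on_slice:
  assumes "transintegral_polyhedral_on T f"
    and "\<And>t. t \<le> X \<Longrightarrow> (c1 + of_int m * t, c2 + of_int n * t) \<in> T"
  shows "\<exists>A. finite A \<and> A \<noteq> {} \<and>
    (\<forall>t\<le>X. f (c1 + of_int m * t, c2 + of_int n * t) = Max ((\<lambda>(k::int, b). of_int k * t + b) ` A))"
proof -
  obtain ls where ls: "ls \<noteq> []" "\<And>l. l \<in> set ls \<Longrightarrow> transintegral_affine l"
    "\<And>p. p \<in> T \<Longrightarrow> f p = Max ((\<lambda>l. l p) ` set ls)"
    using assms(1) unfolding transintegral_polyhedral_on_def by blast
  have "\<forall>l\<in>set ls. \<exists>kb. \<forall>t. l (c1 + of_int m * t, c2 + of_int n * t) = of_int (fst kb :: int) * t + snd kb"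
  proof
    fix l assume "l \<in> set ls"
    then obtain a1 a2 :: int and b where "\<And>x y. l (x, y) = of_int a1 * x + of_int a2 * y + b"
      using ls(2) unfolding transintegral_affine_def by meson
    then show "\<exists>kb. \<forall>t. l (c1 + of_int m * t, c2 + of_int n * t) = of_int (fst kb :: int) * t + snd kb"
      by (intro exI[of _ "(a1 * m + a2 * n, of_int a1 * c1 + of_int a2 * c2 + b)"]) (auto simp: algebra_simps)
  qed
  then obtain kb :: "_ \<Rightarrow> int \<times> real" where kb: "\<And>l t. l \<in> set ls \<Longrightarrow>
      l (c1 + of_int m * t, c2 + of_int n * t) = of_int (fst (kb l)) * t + snd (kb l)"
    by metis
  have "f (c1 + of_int m * t, c2 + of_int n * t) = Max ((\<lambda>(k::int, b). of_int k * t + b) ` kb ` set ls)"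
    if "t \<le> X" for t
    unfolding ls(3)[OF assms(2)[OF that]] image_image using kb
    by (intro arg_cong[where f = Max] image_cong) (auto simp: case_prod_unfold)
  then show ?thesis using ls(1) by (intro exI[of _ "kb ` set ls"]) auto
qed

text \<open>Each functional grows at most linearly in the maximum norm; nonnegative constants can be
  summed over the finite list.\<close>

lemma transintegral_polyhedral_on_growth:
  assumes "transintegral_polyhedral_on T f"
  obtains C where "C \<ge> 0" "\<And>x y. (x, y) \<in> T \<Longrightarrow> f (x, y) \<le> C * (1 + max \<bar>x\<bar> \<bar>y\<bar>)"
proof -
  obtain ls where ls: "ls \<noteq> []" "\<And>l. l \<in> set ls \<Longrightarrow> transintegral_affine l"
    "\<And>p. p \<in> T \<Longrightarrow> f p = Max ((\<lambda>l. l p) ` set ls)"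
    using assms(1) unfolding transintegral_polyhedral_on_def by blast
  have "\<forall>l\<in>set ls. \<exists>C\<ge>0. \<forall>x y. l (x, y) \<le> C * (1 + max \<bar>x\<bar> \<bar>y\<bar>)"
  proof
    fix l assume "l \<in> set ls"
    then obtain a1 a2 :: int and b where l: "\<And>x y. l (x, y) = of_int a1 * x + of_int a2 * y + b"
      using ls(2) unfolding transintegral_affine_def by meson
    have "l (x, y) \<le> (\<bar>of_int a1\<bar> + \<bar>of_int a2\<bar> + \<bar>b\<bar>) * (1 + max \<bar>x\<bar> \<bar>y\<bar>)" for x y
    proof -
      have "of_int a1 * x \<le> \<bar>of_int a1\<bar> * (1 + max \<bar>x\<bar> \<bar>y\<bar>)"
        "of_int a2 * y \<le> \<bar>of_int a2\<bar> * (1 + max \<bar>x\<bar> \<bar>y\<bar>)"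
        by (rule order_trans[OF abs_ge_self], unfold abs_mult, intro mult_left_mono; simp)+
      moreover have "b \<le> \<bar>b\<bar> * (1 + max \<bar>x\<bar> \<bar>y\<bar>)"
        by (rule order_trans[OF abs_ge_self], subst (1) mult_1_right[symmetric]) (intro mult_left_mono; simp)
      ultimately show ?thesis unfolding l by (simp add: algebra_simps)
    qed
    then show "\<exists>C\<ge>0. \<forall>x y. l (x, y) \<le> C * (1 + max \<bar>x\<bar> \<bar>y\<bar>)"
      by (intro exI[of _ "\<bar>of_int a1\<bar> + \<bar>of_int a2\<bar> + \<bar>b\<bar>"]) auto
  qed
  then obtain C where C: "\<And>l. l \<in> set ls \<Longrightarrow> C l \<ge> 0"
     "\<And>l x y. l \<in> set ls \<Longrightarrow> l (x, y) \<le> C l * (1 + max \<bar>x\<bar> \<bar>y\<bar>)" by metis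
  show thesis
  proof (rule that[of "sum C (set ls)"])
    show "sum C (set ls) \<ge> 0" using C by (intro sum_nonneg)
    fix x y assume "(x, y) \<in> T"
    then have "f (x, y) \<in> (\<lambda>l. l (x, y)) ` set ls" using ls by simp
    then obtain l where l: "l \<in> set ls" "f (x, y) = l (x, y)" by auto
    have "C l \<le> sum C (set ls)" using C l by (intro member_le_sum) auto
    then have "C l * (1 + max \<bar>x\<bar> \<bar>y\<bar>) \<le> sum C (set ls) * (1 + max \<bar>x\<bar> \<bar>y\<bar>)"
      by (intro mult_right_mono) auto
    then show "f (x, y) \<le> sum C (set ls) * (1 + max \<bar>x\<bar> \<bar>y\<bar>)"
      using C(2)[OF l(1)] l(2) by (metis order_trans)
  qed
qed

lemma transintegral_polyhedral_if_lines:
  assumes hor: "\<And>c. transintegral_polyhedral_on (horizontal_line c) f"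
    and ver: "\<And>c. transintegral_polyhedral_on (vertical_line c) f"
  shows "transintegral_polyhedral_on UNIV f"
proof -
  have f: "separately_integral_pl f"
    unfolding separately_integral_pl_def
  proof (intro conjI allI integral_plI)
    fix c X
    show "\<exists>A. finite A \<and> A \<noteq> {} \<and> (\<forall>t\<le>X. f (t, c) = Max ((\<lambda>(k::int, b). of_int k * t + b) ` A))"
      using transintegral_polyhedral_on_slice[OF hor[of c], of X 0 1 c 0] by (simp add: horizontal_line_def)
    show "\<exists>A. finite A \<and> A \<noteq> {} \<and> (\<forall>t\<le>X. f (c, t) = Max ((\<lambda>(k::int, b). of_int k * t + b) ` A))"
      using transintegral_polyhedral_on_slice[OF ver[of c], of X c 0 0 1] by (simp add: vertical_line_def)
  qed
  obtain C where C: "C \<ge> 0" "\<And>x. f (x, 0) \<le> C * (1 + \<bar>x\<bar>)"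
    by (rule transintegral_polyhedral_on_growth[OF hor[of 0]]) (auto simp: horizontal_line_def)
  obtain C' where C': "C' \<ge> 0" "\<And>y. f (0, y) \<le> C' * (1 + \<bar>y\<bar>)"
    by (rule transintegral_polyhedral_on_growth[OF ver[of 0]]) (auto simp: vertical_line_def)
  show ?thesis
  proof (rule transintegral_polyhedral_if_growth[OF f])
    fix t :: real assume t: "t \<ge> 0"
    have "0 \<le> C * (1 + t)" "0 \<le> C' * (1 + t)" "0 \<le> C" "0 \<le> C'" using t C C' by auto
    then show "f (- t, 0) \<le> (C + C') * (1 + t)" "f (0, - t) \<le> (C + C') * (1 + t)"
      using C(2)[of "- t"] C'(2)[of "- t"] t by (simp_all add: distrib_right add_increasing add_increasing2)
    \<comment> \<open>The diagonal lies on no axis, but \<open>(t, t)\<close> is the midpoint of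
      \<open>(2 * t, 0)\<close> and \<open>(0, 2 * t)\<close>, so convexity carries the growth bound
      over.\<close>
    have "f (t, t) \<le> f (2 * t, 0) / 2 + f (0, 2 * t) / 2"
      using convex_onD[OF separately_integral_pl_convex[OF f], of "1 / 2" "(2 * t, 0)" "(0, 2 * t)"] by simp
    then show "f (t, t) \<le> (C + C') * (1 + t)"
      using C(2)[of "2 * t"] C'(2)[of "2 * t"] t C C' by (simp add: algebra_simps)
  qed
qed

text \<open>A tripod with apex \<open>(X, c)\<close> or \<open>(c, X)\<close> contains the part up
  to \<open>X\<close> of a horizontal or vertical line. The legs of the tripod at the origin are
  exactly the three rays on which growth must be bounded.\<close>

lemma transintegral_polyhedral_if_tripods:
  assumes tri: "\<And>v. transintegral_polyhedral_on ((+) v ` tripod) f"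
  shows "transintegral_polyhedral_on UNIV f"
proof -
  have f: "separately_integral_pl f"
    unfolding separately_integral_pl_def
  proof (intro conjI allI integral_plI)
    fix c X :: real
    have "(t, c) \<in> (+) (X, c) ` tripod" if "t \<le> X" for t
      using that by (intro image_eqI[of _ _ "(t - X, 0)"]) (auto simp: tripod_def)
    then show "\<exists>A. finite A \<and> A \<noteq> {} \<and> (\<forall>t\<le>X. f (t, c) = Max ((\<lambda>(k::int, b). of_int k * t + b) ` A))"
      using transintegral_polyhedral_on_slice[OF tri[of "(X, c)"], of X 0 1 c 0] by simp
    have "(c, t) \<in> (+) (c, X) ` tripod" if "t \<le> X" for t
      using that by (intro image_eqI[of _ _ "(0, t - X)"]) (auto simp: tripod_def)
    then show "\<exists>A. finite A \<and> A \<noteq> {} \<and> (\<forall>t\<le>X. f (c, t) = Max ((\<lambda>(k::int, b). of_int k * t + b) ` A))"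
      using transintegral_polyhedral_on_slice[OF tri[of "(c, X)"], of X c 0 0 1] by simp
  qed
  have "transintegral_polyhedral_on tripod f"
    using tri[of 0] by (simp add: image_def)
  then obtain C where "\<And>x y. (x, y) \<in> tripod \<Longrightarrow> f (x, y) \<le> C * (1 + max \<bar>x\<bar> \<bar>y\<bar>)"
    by (rule transintegral_polyhedral_on_growth) blast
  note C = this[of "- _" 0] this[of 0 "- _"] this[of t t for t]
  show ?thesis
    by (rule transintegral_polyhedral_if_growth[OF f, of C])
       (use C in \<open>force simp: tripod_def\<close>)+
qed

theorem theorem9p1:
  fixes f :: "real \<times> real \<Rightarrow> real"
  shows "(transintegral_polyhedral_on UNIV f \<longleftrightarrow>
            (\<forall>c. transintegral_polyhedral_on (horizontal_line c) f) \<and>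
            (\<forall>c. transintegral_polyhedral_on (vertical_line c) f)) \<and>
         (transintegral_polyhedral_on UNIV f \<longleftrightarrow>
            (\<forall>v. transintegral_polyhedral_on ((+) v ` tripod) f))"
  using transintegral_polyhedral_on_subset[of UNIV f] transintegral_polyhedral_if_lines[of f]
    transintegral_polyhedral_if_tripods[of f] by blast

end
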